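(* Let $\pi_n(x)=\dfrac{\beta_n(x)}{n+1}$ for $n\ge 0$. Then $\pi_0(x)=1$ and, for every integer $n\geq 0$, $$\pi_{n+1}(x)=x\,\pi_{n}(x)-\sum_{j=1}^{n}\frac{2^{j+1}}{j+1}\binom{n}{j}\left\vert B_{j+1}\right\vert\pi_{n-j}(x),$$ where $B_{n}$ denote the Bernoulli numbers.
   Context: For each integer $n\ge 0$, $\beta_n$ is the polynomial with real coefficients determined by $\beta_n(x)=\operatorname{Im}((x+i)^{n+1})$ for real $x$, i.e. $\beta_n(x)=\sum_{k=0}^{\lfloor n/2\rfloor}(-1)^k\binom{n+1}{2k+1}x^{n-2k}$; thus $\pi_n$ is monic of degree $n$. The Bernoulli numbers are given by $\frac{t}{e^t-1}=\sum_{n\ge0}B_n\frac{t^n}{n!}$. An empty sum is $0$. *)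

theory Defs
  imports "HOL-Analysis.Analysis" "HOL-Computational_Algebra.Computational_Algebra"
begin

definition beta_poly :: "nat \<Rightarrow> real poly" where
  "beta_poly n =
    (\<Sum>k=0..n div 2. monom ((-1) ^ k * real ((n + 1) choose (2 * k + 1))) (n - 2 * k))"

(* the property that determines beta_poly *)
lemma poly_beta_poly: "poly (beta_poly n) x = Im ((complex_of_real x + \<i>) ^ (n + 1))"
proof -
  define g where
    "g j = Im (of_nat ((n + 1) choose j) * \<i> ^ j * complex_of_real x ^ (n + 1 - j))" for j
  have Im_i_even: "Im (\<i> ^ j) = 0" if "even j" for j
    using that by (auto elim!: evenE simp: power_mult)
  have Im_i_odd: "Im (\<i> ^ (2 * k + 1)) = (-1) ^ k" for k
    by (simp add: power_mult)
  have Im_of_real: "Im (of_nat a * z * complex_of_real x ^ m) = real a * Im z * x ^ m" for a z m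
    by (simp flip: of_real_power)
  have "Im ((complex_of_real x + \<i>) ^ (n + 1)) = (\<Sum>j\<le>n+1. g j)"
    unfolding g_def by (subst add.commute, subst binomial_ring) (simp add: Im_sum)
  also have "\<dots> = (\<Sum>j\<in>(\<lambda>k. 2 * k + 1) ` {0..n div 2}. g j)"
  proof (rule sum.mono_neutral_right)
    show "\<forall>j\<in>{..n+1} - (\<lambda>k. 2 * k + 1) ` {0..n div 2}. g j = 0"
    proof
      fix j assume j: "j \<in> {..n+1} - (\<lambda>k. 2 * k + 1) ` {0..n div 2}"
      have "even j"
      proof (rule ccontr)
        assume "odd j"
        then obtain k where "j = 2 * k + 1" by (elim oddE)
        moreover from this j have "k \<le> n div 2" by auto
        ultimately show False using j by auto
      qed
      then show "g j = 0" unfolding g_def Im_of_real by (simp add: Im_i_even)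
    qed
  qed auto
  also have "\<dots> = (\<Sum>k=0..n div 2. g (2 * k + 1))"
    by (subst sum.reindex) (auto simp: inj_on_def)
  also have "\<dots> = poly (beta_poly n) x"
    unfolding g_def Im_of_real Im_i_odd beta_poly_def poly_sum poly_monom
    by (intro sum.cong) (auto simp: mult_ac)
  finally show ?thesis by simp
qed

definition pi_poly :: "nat \<Rightarrow> real poly" where
  "pi_poly n = smult (1 / real (n + 1)) (beta_poly n)"

(* The divisor has no constant term, but the quotient of formal power series is exact:
   both series have subdegree 1 (see bernoulli_gf). *)
definition bernoulli :: "nat \<Rightarrow> real" where
  "bernoulli n = fact n * fps_nth (fps_X / (fps_exp 1 - 1)) n"

lemma bernoulli_gf:
  "Abs_fps (\<lambda>n. bernoulli n / fact n) * (fps_exp 1 - 1) = fps_X"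
proof -
  have *: "Abs_fps (\<lambda>n. bernoulli n / fact n) = fps_X / (fps_exp 1 - 1)"
    by (rule fps_ext) (simp add: bernoulli_def)
  have "subdegree (fps_exp (1::real) - 1) = 1"
    by (rule subdegreeI) auto
  moreover from this have "fps_exp (1::real) - 1 \<noteq> 0" by auto
  ultimately have "fps_exp (1::real) - 1 dvd fps_X"
    by (simp add: fps_dvd_iff)
  then show ?thesis unfolding * by simp
qed

end

theory Submission
  imports Defs
begin

unbundle no vec_syntax

text \<open>
  The generating function \<open>F = \<Sum> \<pi>\<^sub>n(x) t\<^sup>n / n!\<close> equals \<open>e\<^sup>x\<^sup>t sin t / t\<close>, so
  \<open>t F' = x t F - (1 - t cot t) F\<close>, and comparing coefficients gives the recurrence as soon as
  \<open>1 - t cot t = \<Sum>\<^sub>n\<^sub>\<ge>\<^sub>2 2\<^sup>n \<bar>B\<^sub>n\<bar> t\<^sup>n / n!\<close>. Both sides of the last identity satisfy the Riccati equation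
  \<open>t c' + c = t\<^sup>2 + c\<^sup>2\<close>: for the left side this is the equation for \<open>cot\<close>; for the right side it comes
  from the one for \<open>t / (e\<^sup>t - 1)\<close>, and the recurrence it implies makes the coefficients nonnegative,
  which accounts for the absolute values.
\<close>

text \<open>Since \<open>a $ 0 = 0\<close>, the coefficient of index \<open>n\<close> on the right
  involves only earlier coefficients of \<open>d\<close>, while on the left it is \<open>n\<close>
  times \<open>d $ n\<close>; so the zero at index 0 propagates.\<close>

lemma fps_euler_ode_unique:
  fixes a d :: "'a::field_char_0 fps"
  assumes ode: "fps_X * fps_deriv d = a * d" and "a $ 0 = 0" "d $ 0 = 0"
  shows "d = 0"
proof -
  have "d $ n = 0" for n
  proof (induction n rule: less_induct)
    case (less n)
    show ?case
    proof (cases n)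
      case 0
      then show ?thesis using assms by simp
    next
      case (Suc m)
      have "of_nat n * d $ n = (fps_X * fps_deriv d) $ n"
        using Suc by simp
      also have "\<dots> = (\<Sum>i=0..n. a $ i * d $ (n - i))"
        by (simp add: ode fps_mult_nth)
      also have "\<dots> = 0"
      proof (intro sum.neutral ballI)
        fix i assume "i \<in> {0..n}"
        then show "a $ i * d $ (n - i) = 0"
          using less.IH[of "n - i"] \<open>a $ 0 = 0\<close> Suc by (cases "i = 0") auto
      qed
      finally show ?thesis using Suc by (simp del: of_nat_Suc)
    qed
  qed
  then show ?thesis by (simp add: fps_eq_iff)
qed

section \<open>Riccati equation for the Bernoulli generating function\<close>

definition bernoulli_fps :: "real fps" where
  "bernoulli_fps = Abs_fps (\<lambda>n. bernoulli n / fact n)"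

lemma bernoulli_fps_nth [simp]: "bernoulli_fps $ n = bernoulli n / fact n"
  by (simp add: bernoulli_fps_def)

lemma bernoulli_0: "bernoulli 0 = 1"
  using arg_cong[OF bernoulli_gf, of "\<lambda>f. f $ 1"] by (simp add: fps_mult_nth)

lemma bernoulli_1: "bernoulli 1 = - 1 / 2"
  using arg_cong[OF bernoulli_gf, of "\<lambda>f. f $ 2"]
  by (simp add: fps_mult_nth bernoulli_0 eval_nat_numeral)

lemma bernoulli_fps_ode:
  "fps_X * fps_deriv bernoulli_fps = bernoulli_fps - fps_X * bernoulli_fps - bernoulli_fps ^ 2"
proof -
  define b where "b = bernoulli_fps"
  define e :: "real fps" where "e = fps_exp 1"
  have gf: "b * (e - 1) = fps_X"
    unfolding b_def e_def bernoulli_fps_def by (rule bernoulli_gf)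
  have "fps_deriv b * (e - 1) + b * e = 1"
    using arg_cong[OF gf, of fps_deriv] by (simp add: e_def add.commute)
  \<comment> \<open>The extra factor \<open>b\<close> lets every \<open>e\<close> be absorbed into a
    product \<open>b * (e - 1)\<close>, which is \<open>fps_X\<close>.\<close>
  then have "b * (fps_deriv b * (e - 1) + b * e) = b" by simp
  moreover have "b * (fps_deriv b * (e - 1) + b * e)
      = (b * (e - 1)) * fps_deriv b + b * (b * (e - 1)) + b ^ 2"
    by (simp add: algebra_simps power2_eq_square)
  ultimately have "fps_X * fps_deriv b + b * fps_X + b ^ 2 = b" unfolding gf by simp
  then show ?thesis unfolding b_def by (simp add: eq_diff_eq ac_simps)
qed

text \<open>Removing the first two terms of \<open>t / (e\<^sup>t - 1)\<close> leaves an even series.\<close>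

definition bernoulli_tail :: "real fps" where
  "bernoulli_tail = bernoulli_fps - 1 + fps_const (1/2) * fps_X"

lemma bernoulli_tail_nth_ge_2: "n \<ge> 2 \<Longrightarrow> bernoulli_tail $ n = bernoulli n / fact n"
  by (simp add: bernoulli_tail_def fps_X_def)

lemma bernoulli_tail_0 [simp]: "bernoulli_tail $ 0 = 0"
  by (simp add: bernoulli_tail_def bernoulli_0)

lemma bernoulli_tail_1 [simp]: "bernoulli_tail $ Suc 0 = 0"
  using bernoulli_1 by (simp add: bernoulli_tail_def)

text \<open>The shift by \<open>1 - fps_X / 2\<close> cancels the terms that change sign under t ->
  -t. This symmetry is behind the vanishing of the odd coefficients.\<close>

lemma bernoulli_tail_ode:
  "fps_X * fps_deriv bernoulli_tail + bernoulli_tail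
    = fps_const (1/4) * fps_X ^ 2 - bernoulli_tail ^ 2"
proof -
  define g y where "g = bernoulli_tail" and "y = fps_const (1/2 :: real) * fps_X"
  have X: "fps_X = y + y"
    unfolding y_def by (simp flip: distrib_right)
  have "y * y = (fps_const (1/2) * fps_const (1/2)) * fps_X ^ 2"
    unfolding y_def power2_eq_square by (simp only: mult_ac)
  then have sq: "y * y = fps_const (1/4) * fps_X ^ 2" by simp
  have b: "bernoulli_fps = 1 - y + g"
    by (simp add: g_def y_def bernoulli_tail_def)
  have "fps_X * fps_deriv bernoulli_fps = fps_X * fps_deriv g - y"
    unfolding b by (simp add: y_def algebra_simps)
  then have "fps_X * fps_deriv g - y = (1 - y + g) - (y + y) * (1 - y + g) - (1 - y + g) ^ 2"
    using bernoulli_fps_ode unfolding b X by simp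
  then have "fps_X * fps_deriv g + g = y * y - g ^ 2"
    by (simp add: algebra_simps power2_eq_square)
  then show ?thesis by (simp add: g_def sq)
qed

lemma bernoulli_tail_rec:
  "real (n + 1) * bernoulli_tail $ n
    = (if n = 2 then 1/4 else 0) - (\<Sum>i=0..n. bernoulli_tail $ i * bernoulli_tail $ (n - i))"
proof -
  have "(fps_X * fps_deriv bernoulli_tail + bernoulli_tail) $ n = real (n + 1) * bernoulli_tail $ n"
    by (cases n) (auto simp: algebra_simps)
  then show ?thesis
    unfolding bernoulli_tail_ode
    by (cases "n = 2") (simp_all add: power2_eq_square[of bernoulli_tail] fps_mult_nth[of bernoulli_tail])
qed

text \<open>If \<open>n\<close> is odd, each product in the recurrence has a factor of odd index;
  the two end products vanish through \<open>bernoulli_tail_0\<close>, the others by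
  induction.\<close>

lemma bernoulli_tail_odd:
  assumes "odd n"
  shows "bernoulli_tail $ n = 0"
  using assms
proof (induction n rule: less_induct)
  case (less n)
  have "bernoulli_tail $ i * bernoulli_tail $ (n - i) = 0" if "i \<le> n" for i
  proof (cases "i = 0 \<or> i = n")
    case False
    with that less.prems have "odd i \<or> odd (n - i)" by auto
    moreover have "i < n" "n - i < n" using that False by auto
    ultimately show ?thesis using less.IH by (metis mult_eq_0_iff)
  qed auto
  then have "(\<Sum>i=0..n. bernoulli_tail $ i * bernoulli_tail $ (n - i)) = 0"
    by (intro sum.neutral) simp
  then have "real (n + 1) * bernoulli_tail $ n = 0"
    using less.prems by (subst bernoulli_tail_rec) auto
  then show ?case by (simp del: of_nat_add)
qed

text \<open>The expansion of \<open>1 - t cot t\<close>, obtained from the even series above by \<open>t \<mapsto> 2it\<close> and a sign.\<close>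

definition cot_tail :: "real fps" where
  "cot_tail = Abs_fps (\<lambda>n. - ((-1) ^ (n div 2) * 2 ^ n * bernoulli_tail $ n))"

lemma cot_tail_0 [simp]: "cot_tail $ 0 = 0"
  and cot_tail_1 [simp]: "cot_tail $ Suc 0 = 0"
  by (simp_all add: cot_tail_def)

text \<open>Only products of two even indices survive, and on even indices the sign
  \<open>(-1) ^ (n div 2)\<close> is multiplicative. The outer minus makes the quadratic term
  positive.\<close>

lemma cot_tail_rec:
  "real (n + 1) * cot_tail $ n
    = (if n = 2 then 1 else 0) + (\<Sum>i=0..n. cot_tail $ i * cot_tail $ (n - i))"
proof -
  let ?s = "(-1) ^ (n div 2) * 2 ^ n :: real"
  have prod: "cot_tail $ i * cot_tail $ (n - i)
      = ?s * (bernoulli_tail $ i * bernoulli_tail $ (n - i))" if "i \<le> n" for i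
  proof (cases "even i \<and> even (n - i)")
    case True
    then obtain k l where kl: "i = 2 * k" "n - i = 2 * l" by (elim conjE evenE)
    then have "n = 2 * (k + l)" using that by simp
    then show ?thesis unfolding kl by (simp add: cot_tail_def power_add distrib_left)
  next
    case False
    then have "bernoulli_tail $ i * bernoulli_tail $ (n - i) = 0"
      using bernoulli_tail_odd by (metis mult_eq_0_iff)
    then show ?thesis by (auto simp: cot_tail_def)
  qed
  have "real (n + 1) * cot_tail $ n = - ?s * (real (n + 1) * bernoulli_tail $ n)"
    by (simp add: cot_tail_def)
  \<comment> \<open>At \<open>n = 2\<close> the factor \<open>- ?s\<close> is 4, which turns 1/4
    into 1.\<close>
  also have "\<dots> = (if n = 2 then 1 else 0)
      + (\<Sum>i=0..n. ?s * (bernoulli_tail $ i * bernoulli_tail $ (n - i)))"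
    unfolding bernoulli_tail_rec by (auto simp: algebra_simps sum_distrib_left)
  also have "(\<Sum>i=0..n. ?s * (bernoulli_tail $ i * bernoulli_tail $ (n - i)))
      = (\<Sum>i=0..n. cot_tail $ i * cot_tail $ (n - i))"
    by (intro sum.cong) (auto simp: prod)
  finally show ?thesis .
qed

lemma cot_tail_ode: "fps_X * fps_deriv cot_tail + cot_tail = fps_X ^ 2 + cot_tail ^ 2"
proof (rule fps_ext)
  fix n
  have "(fps_X * fps_deriv cot_tail + cot_tail) $ n = real (n + 1) * cot_tail $ n"
    by (cases n) (auto simp: algebra_simps)
  also note cot_tail_rec
  finally show "(fps_X * fps_deriv cot_tail + cot_tail) $ n = (fps_X ^ 2 + cot_tail ^ 2) $ n"
    by (simp add: power2_eq_square[of cot_tail] fps_mult_nth)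
qed

lemma cot_tail_nonneg: "cot_tail $ n \<ge> 0"
proof (induction n rule: less_induct)
  case (less n)
  have "cot_tail $ i * cot_tail $ (n - i) \<ge> 0" if "i \<le> n" for i
    using that less.IH[of i] less.IH[of "n - i"] by (cases "i = 0 \<or> i = n") auto
  then have "real (n + 1) * cot_tail $ n \<ge> 0"
    unfolding cot_tail_rec by (intro add_nonneg_nonneg sum_nonneg) auto
  then show ?case by (simp add: zero_le_mult_iff)
qed

text \<open>Nonnegativity replaces any knowledge of the signs of the Bernoulli numbers.\<close>

lemma cot_tail_nth_ge_2:
  assumes "n \<ge> 2"
  shows "cot_tail $ n = 2 ^ n * \<bar>bernoulli n\<bar> / fact n"
proof -
  have "cot_tail $ n = \<bar>cot_tail $ n\<bar>" using cot_tail_nonneg by simp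
  also have "\<dots> = 2 ^ n * \<bar>bernoulli n\<bar> / fact n"
    using assms by (simp add: cot_tail_def bernoulli_tail_nth_ge_2 abs_mult power_abs)
  finally show ?thesis .
qed

text \<open>The real and imaginary parts of \<open>e\<^bsup>(x + i) t\<^esup>\<close>, that is, \<open>e\<^sup>x\<^sup>t cos t\<close> and \<open>e\<^sup>x\<^sup>t sin t\<close>.\<close>

definition exp_cos_fps :: "real \<Rightarrow> real fps" where
  "exp_cos_fps x = Abs_fps (\<lambda>n. Re ((complex_of_real x + \<i>) ^ n) / fact n)"

definition exp_sin_fps :: "real \<Rightarrow> real fps" where
  "exp_sin_fps x = Abs_fps (\<lambda>n. Im ((complex_of_real x + \<i>) ^ n) / fact n)"

lemma fps_deriv_exp_cos:
  "fps_deriv (exp_cos_fps x) = fps_const x * exp_cos_fps x - exp_sin_fps x"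
  by (rule fps_ext) (simp add: exp_cos_fps_def exp_sin_fps_def field_simps del: of_nat_Suc)

lemma fps_deriv_exp_sin:
  "fps_deriv (exp_sin_fps x) = fps_const x * exp_sin_fps x + exp_cos_fps x"
  by (rule fps_ext) (simp add: exp_cos_fps_def exp_sin_fps_def field_simps del: of_nat_Suc)

text \<open>This identifies \<open>cot_tail\<close> with 1 - t cot t, in a form free of division by
  the sine: the difference of the two sides solves a homogeneous Euler equation.\<close>

lemma cot_tail_times_exp_sin:
  "cot_tail * exp_sin_fps x = exp_sin_fps x - fps_X * exp_cos_fps x"
proof -
  define c p q k where "c = cot_tail" and "p = exp_sin_fps x" and "q = exp_cos_fps x"
    and "k = fps_const x"
  define d where "d = c * p - p + fps_X * q"
  have p': "fps_deriv p = k * p + q" and q': "fps_deriv q = k * q - p"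
    by (simp_all add: p_def q_def k_def fps_deriv_exp_sin fps_deriv_exp_cos)
  have c': "fps_X * fps_deriv c = fps_X ^ 2 + c ^ 2 - c"
    using cot_tail_ode by (simp add: c_def algebra_simps)
  have d': "fps_deriv d
      = fps_deriv c * p + c * (k * p + q) - (k * p + q) + q + fps_X * (k * q - p)"
    unfolding d_def by (simp add: p' q' algebra_simps)
  \<comment> \<open>The \<open>fps_X ^ 2 * p\<close> from the Riccati equation cancels the one from
    \<open>fps_deriv q\<close>.\<close>
  have "fps_X * fps_deriv d = (c + k * fps_X) * d"
    using c' unfolding d' unfolding d_def by algebra
  moreover have "(c + k * fps_X) $ 0 = 0" "d $ 0 = 0"
    by (simp_all add: c_def d_def p_def k_def exp_sin_fps_def)
  ultimately have "d = 0" by (rule fps_euler_ode_unique)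
  then show ?thesis by (simp add: d_def c_def p_def q_def algebra_simps)
qed

section \<open>Generating function of the polynomials and the recurrence\<close>

definition pi_fps :: "real \<Rightarrow> real fps" where
  "pi_fps x = Abs_fps (\<lambda>n. poly (pi_poly n) x / fact n)"

lemma exp_sin_eq_X_times_pi: "exp_sin_fps x = fps_X * pi_fps x"
proof (rule fps_ext)
  fix n
  show "exp_sin_fps x $ n = (fps_X * pi_fps x) $ n"
    by (cases n) (simp_all add: exp_sin_fps_def pi_fps_def pi_poly_def poly_beta_poly)
qed

text \<open>Cancelling \<open>fps_X\<close> in the cotangent identity and differentiating
  \<open>fps_X * pi_fps x\<close> give two relations, from which \<open>exp_cos_fps x\<close> is
  eliminated.\<close>

lemma pi_fps_ode:
  "fps_X * fps_deriv (pi_fps x) = fps_const x * fps_X * pi_fps x - cot_tail * pi_fps x"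
proof -
  have "fps_X * (cot_tail * pi_fps x) = fps_X * (pi_fps x - exp_cos_fps x)"
    using cot_tail_times_exp_sin[of x] by (simp add: exp_sin_eq_X_times_pi algebra_simps)
  then have "cot_tail * pi_fps x = pi_fps x - exp_cos_fps x"
    by (simp only: mult_cancel_left fps_X_neq_zero simp_thms)
  moreover have "pi_fps x + fps_X * fps_deriv (pi_fps x)
      = fps_const x * (fps_X * pi_fps x) + exp_cos_fps x"
    using fps_deriv_exp_sin[of x] by (simp add: exp_sin_eq_X_times_pi algebra_simps)
  ultimately show ?thesis by algebra
qed

lemma poly_pi_poly_Suc:
  "poly (pi_poly (n + 1)) x = x * poly (pi_poly n) x
    - (\<Sum>j=1..n. 2 ^ (j + 1) / real (j + 1) * real (n choose j) * \<bar>bernoulli (j + 1)\<bar>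
        * poly (pi_poly (n - j)) x)"
proof -
  let ?p = "\<lambda>n. poly (pi_poly n) x"
  have "?p (n + 1) / fact n = (fps_X * fps_deriv (pi_fps x)) $ (n + 1)"
    by (simp add: pi_fps_def field_simps del: of_nat_Suc)
  also have "\<dots> = x * ?p n / fact n - (cot_tail * pi_fps x) $ (n + 1)"
    unfolding pi_fps_ode by (simp add: pi_fps_def mult.assoc)
  \<comment> \<open>The sum may start at 2 because \<open>cot_tail\<close> has no terms of degree 0
    and 1.\<close>
  also have "(cot_tail * pi_fps x) $ (n + 1)
      = (\<Sum>i=2..n+1. cot_tail $ i * pi_fps x $ (n + 1 - i))"
    unfolding fps_mult_nth
  proof (rule sum.mono_neutral_right)
    show "\<forall>i\<in>{0..n+1} - {2..n+1}. cot_tail $ i * pi_fps x $ (n + 1 - i) = 0"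
    proof
      fix i assume "i \<in> {0..n+1} - {2..n+1}"
      then have "i = 0 \<or> i = Suc 0" by auto
      then show "cot_tail $ i * pi_fps x $ (n + 1 - i) = 0" by auto
    qed
  qed auto
  also have "\<dots> = (\<Sum>j=1..n. cot_tail $ (j + 1) * pi_fps x $ (n - j))"
    using sum.shift_bounds_cl_nat_ivl
      [of "\<lambda>i. cot_tail $ i * pi_fps x $ (n + 1 - i)" 1 1 n] by (simp add: numeral_2_eq_2)
  finally have "?p (n + 1) = x * ?p n
      - (\<Sum>j=1..n. fact n * (cot_tail $ (j + 1) * pi_fps x $ (n - j)))"
    by (simp add: field_simps flip: sum_distrib_left)
  also have "(\<Sum>j=1..n. fact n * (cot_tail $ (j + 1) * pi_fps x $ (n - j)))
      = (\<Sum>j=1..n. 2 ^ (j + 1) / real (j + 1) * real (n choose j) * \<bar>bernoulli (j + 1)\<bar> * ?p (n - j))"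
  proof (rule sum.cong)
    fix j assume j: "j \<in> {1..n}"
    then have "real (n choose j) = fact n / (fact j * fact (n - j))"
      by (simp add: binomial_fact)
    then show "fact n * (cot_tail $ (j + 1) * pi_fps x $ (n - j))
        = 2 ^ (j + 1) / real (j + 1) * real (n choose j) * \<bar>bernoulli (j + 1)\<bar> * ?p (n - j)"
      using j by (simp add: cot_tail_nth_ge_2 pi_fps_def mult_ac)
  qed simp
  finally show ?thesis .
qed

theorem theorem11:
  shows "pi_poly 0 = 1 \<and>
    (\<forall>n::nat. pi_poly (n + 1) = [:0, 1:] * pi_poly n
      - (\<Sum>j=1..n. smult (2 ^ (j + 1) / real (j + 1) * real (n choose j) * \<bar>bernoulli (j + 1)\<bar>)
           (pi_poly (n - j))))"
proof (intro conjI allI)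
  show "pi_poly 0 = 1"
    by (simp add: pi_poly_def beta_poly_def monom_0)
next
  fix n
  show "pi_poly (n + 1) = [:0, 1:] * pi_poly n
      - (\<Sum>j=1..n. smult (2 ^ (j + 1) / real (j + 1) * real (n choose j) * \<bar>bernoulli (j + 1)\<bar>)
           (pi_poly (n - j)))"
    \<comment> \<open>Real polynomials with equal values everywhere are equal, so the pointwise
      recurrence suffices.\<close>
    unfolding poly_eq_poly_eq_iff[symmetric]
    by (rule ext) (simp only: poly_pi_poly_Suc poly_diff poly_mult poly_sum poly_smult, simp)
qed

end
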